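(* Let $d\ge 1$ and let $\mathcal{A}_1$ be the arcsine transformation of measures on $\mathbb{R}^d$, with domain $\mathfrak{D}(\mathcal{A}_1)$. Then $\mathfrak{D}(\mathcal{A}_{1})=\mathfrak{M}_{L}^{1}(\mathbb{R}^{d})$.
   Context: $\mathfrak{M}_L(\mathbb{R}^d)$ is the class of Lévy measures on $\mathbb{R}^d$: measures $\nu$ with $\nu(\{0\})=0$ and $\int_{\mathbb{R}^d}(1\wedge|x|^2)\,\nu(\mathrm{d}x)<\infty$. $\mathfrak{M}_L^1(\mathbb{R}^d)$ is the class of $\nu\in\mathfrak{M}_L(\mathbb{R}^d)$ with $\int_{\mathbb{R}^d}(1\wedge|x|)\,\nu(\mathrm{d}x)<\infty$. For $s>0$ let $a_1(r;s)=2\pi^{-1}(s-r^2)^{-1/2}1_{(0,s^{1/2})}(r)$. For a measure $\nu$ on $\mathbb{R}^d$ define $$\mathcal{A}_1(\nu)(B)=\int_{\mathbb{R}^d\setminus\{0\}}\nu(\mathrm{d}x)\int_0^\infty a_1(r;|x|)\,1_B\!\left(r\frac{x}{|x|}\right)\mathrm{d}r,\qquad B\in\mathcal{B}(\mathbb{R}^d).$$ The domain $\mathfrak{D}(\mathcal{A}_1)$ is the class of measures $\nu$ on $\mathbb{R}^d$ such that $\nu(\{0\})=0$ and the right-hand side, as a function of $B$, is a measure belonging to $\mathfrak{M}_L(\mathbb{R}^d)$. *)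

theory Defs
  imports "HOL-Analysis.Analysis"
begin

text \<open>A measure on a Euclidean space is a measure on its Borel sets; it need not be
  \<open>\<sigma>\<close>-finite.\<close>

definition levy_measures :: "'a::euclidean_space measure set" where
  "levy_measures =
     {\<nu>. sets \<nu> = sets borel \<and> emeasure \<nu> {0} = 0 \<and>
          (\<integral>\<^sup>+x. ennreal (min 1 ((norm x)\<^sup>2)) \<partial>\<nu>) < \<infinity>}"

definition levy_measures1 :: "'a::euclidean_space measure set" where
  "levy_measures1 =
     {\<nu> \<in> levy_measures. (\<integral>\<^sup>+x. ennreal (min 1 (norm x)) \<partial>\<nu>) < \<infinity>}"

definition arcsine_density :: "real \<Rightarrow> real \<Rightarrow> real" where
  "arcsine_density r s = 2 / pi * (s - r\<^sup>2) powr (- 1 / 2) * indicator {0<..<sqrt s} r"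

definition arcsine_set_function :: "'a::euclidean_space measure \<Rightarrow> 'a set \<Rightarrow> ennreal" where
  "arcsine_set_function \<nu> B =
     (\<integral>\<^sup>+x\<in>UNIV - {0}.
        (\<integral>\<^sup>+r\<in>{0<..}. ennreal (arcsine_density r (norm x)) *
            indicator B (r *\<^sub>R (x /\<^sub>R norm x)) \<partial>lborel) \<partial>\<nu>)"

definition arcsine_transform :: "'a::euclidean_space measure \<Rightarrow> 'a measure" where
  "arcsine_transform \<nu> = measure_of UNIV (sets borel) (arcsine_set_function \<nu>)"

text \<open>The conjunct \<^const>\<open>measure_space\<close> is needed because \<^const>\<open>measure_of\<close> yields the
  null measure when its third argument is not countably additive.\<close>

definition arcsine_domain :: "'a::euclidean_space measure set" where
  "arcsine_domain =
     {\<nu>. sets \<nu> = sets borel \<and> emeasure \<nu> {0} = 0 \<and>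
          measure_space UNIV (sets borel) (arcsine_set_function \<nu>) \<and>
          arcsine_transform \<nu> \<in> levy_measures}"

end

theory Submission
  imports Defs
begin

text \<open>
  The transformation \<open>\<A>\<^sub>1\<close> spreads the mass of \<open>\<nu>\<close> at a point \<open>x \<noteq> 0\<close> along the ray
  through \<open>x\<close>, to the radii below \<open>sqrt (norm x)\<close>, by a probability law that is the
  arcsine law scaled by \<open>sqrt (norm x)\<close>. So the square of the new radius is comparable
  with the old radius, and the integral of \<open>min 1 (norm y)\<^sup>2\<close> against \<open>\<A>\<^sub>1(\<nu>)\<close> is comparable
  with the integral of \<open>min 1 (norm x)\<close> against \<open>\<nu>\<close>; this is the whole reason for the
  result.

  In detail, \<open>\<A>\<^sub>1(\<nu>)\<close> is the image of \<open>\<nu>\<close> under a measurable kernel. It is therefore a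
  measure for every \<open>\<nu>\<close>, \<open>\<sigma>\<close>-finite or not, and its integrals are iterated
  integrals (\<open>nn_integral_arcsine_transform\<close>). The kernel integral \<open>K x\<close> of
  \<open>min 1 (norm y)\<^sup>2\<close> satisfies
  \<open>min 1 (norm x) / (4 * pi) \<le> K x \<le> min 1 (norm x)\<close>
  (\<open>arcsine_kernel_ge\<close> and \<open>arcsine_kernel_le\<close>). Integration of these bounds gives the
  two inclusions.
\<close>

section \<open>The arcsine transform as the image under a kernel\<close>

definition arcsine_kernel :: "('a::euclidean_space \<Rightarrow> ennreal) \<Rightarrow> 'a \<Rightarrow> ennreal" where
  "arcsine_kernel f x =
     (\<integral>\<^sup>+r\<in>{0<..}. ennreal (arcsine_density r (norm x)) * f (r *\<^sub>R (x /\<^sub>R norm x)) \<partial>lborel)"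

lemma arcsine_set_function_eq:
  "arcsine_set_function \<nu> B = (\<integral>\<^sup>+x\<in>UNIV - {0}. arcsine_kernel (indicator B) x \<partial>\<nu>)"
  by (simp add: arcsine_set_function_def arcsine_kernel_def)

lemma arcsine_density_measurable:
  "(\<lambda>p. arcsine_density (snd p) (norm (fst p)))
     \<in> borel_measurable ((borel :: 'a::euclidean_space measure) \<Otimes>\<^sub>M lborel)"
proof -
  have *: "arcsine_density r s =
      (if 0 < r \<and> r < sqrt s then 2 / pi * (s - r\<^sup>2) powr (- 1 / 2) else 0)" for r s
    by (simp add: arcsine_density_def)
  show ?thesis
    unfolding * by measurable
qed

lemma arcsine_density_measurable1 [measurable]:
  "(\<lambda>r. arcsine_density r s) \<in> borel_measurable borel"
proof -
  have *: "arcsine_density r s =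
      (if 0 < r \<and> r < sqrt s then 2 / pi * (s - r\<^sup>2) powr (- 1 / 2) else 0)" for r
    by (simp add: arcsine_density_def)
  show ?thesis
    unfolding * by measurable
qed

lemma arcsine_integrand_measurable:
  assumes [measurable]: "f \<in> borel_measurable (borel :: 'a::euclidean_space measure)"
  shows "(\<lambda>r. ennreal (arcsine_density r (norm x)) * f (r *\<^sub>R (x /\<^sub>R norm x))
            * indicator {0<..} r) \<in> borel_measurable lborel"
  by measurable

text \<open>The integral is over \<open>r\<close>, against Lebesgue measure, and the integrand is jointly
  measurable in \<open>x\<close> and \<open>r\<close>; so the \<open>\<sigma>\<close>-finiteness of Lebesgue measure gives
  measurability in \<open>x\<close>.\<close>

lemma arcsine_kernel_measurable [measurable]:
  assumes [measurable]: "f \<in> borel_measurable (borel :: 'a::euclidean_space measure)"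
  shows "arcsine_kernel f \<in> borel_measurable borel"
proof -
  note [measurable] = arcsine_density_measurable
  have "(\<lambda>p :: 'a \<times> real. ennreal (arcsine_density (snd p) (norm (fst p))) *
          f (snd p *\<^sub>R (fst p /\<^sub>R norm (fst p))) * indicator {0<..} (snd p))
        \<in> borel_measurable (borel \<Otimes>\<^sub>M lborel)"
    by measurable
  then show ?thesis
    unfolding arcsine_kernel_def
    by (intro lborel.borel_measurable_nn_integral) (simp add: case_prod_beta)
qed

lemma arcsine_kernel_cmult:
  assumes [measurable]: "f \<in> borel_measurable (borel :: 'a::euclidean_space measure)"
  shows "arcsine_kernel (\<lambda>x. c * f x) x = c * arcsine_kernel f x"
proof -
  have "arcsine_kernel (\<lambda>x. c * f x) x =
      (\<integral>\<^sup>+r. c * (ennreal (arcsine_density r (norm x)) * f (r *\<^sub>R (x /\<^sub>R norm x))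
          * indicator {0<..} r) \<partial>lborel)"
    unfolding arcsine_kernel_def by (simp add: ac_simps)
  then show ?thesis
    unfolding arcsine_kernel_def
    using arcsine_integrand_measurable[OF assms] by (simp add: nn_integral_cmult)
qed

lemma arcsine_kernel_add:
  assumes [measurable]: "f \<in> borel_measurable (borel :: 'a::euclidean_space measure)"
      "g \<in> borel_measurable (borel :: 'a::euclidean_space measure)"
  shows "arcsine_kernel (\<lambda>x. f x + g x) x = arcsine_kernel f x + arcsine_kernel g x"
proof -
  have "arcsine_kernel (\<lambda>x. f x + g x) x =
      (\<integral>\<^sup>+r. ennreal (arcsine_density r (norm x)) * f (r *\<^sub>R (x /\<^sub>R norm x)) * indicator {0<..} r
          + ennreal (arcsine_density r (norm x)) * g (r *\<^sub>R (x /\<^sub>R norm x)) * indicator {0<..} r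
          \<partial>lborel)"
    unfolding arcsine_kernel_def by (simp add: distrib_left distrib_right)
  then show ?thesis
    unfolding arcsine_kernel_def
    using assms[THEN arcsine_integrand_measurable] by (simp add: nn_integral_add)
qed

lemma arcsine_kernel_suminf:
  fixes f :: "nat \<Rightarrow> 'a::euclidean_space \<Rightarrow> ennreal"
  assumes "\<And>i. f i \<in> borel_measurable borel"
  shows "arcsine_kernel (\<lambda>x. \<Sum>i. f i x) x = (\<Sum>i. arcsine_kernel (f i) x)"
proof -
  have "arcsine_kernel (\<lambda>x. \<Sum>i. f i x) x =
      (\<integral>\<^sup>+r. (\<Sum>i. ennreal (arcsine_density r (norm x)) * f i (r *\<^sub>R (x /\<^sub>R norm x))
          * indicator {0<..} r) \<partial>lborel)"
    unfolding arcsine_kernel_def by simp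
  also have "\<dots> = (\<Sum>i. arcsine_kernel (f i) x)"
    unfolding arcsine_kernel_def
    by (rule nn_integral_suminf) (rule arcsine_integrand_measurable[OF assms])
  finally show ?thesis .
qed

lemma arcsine_kernel_SUP:
  fixes f :: "nat \<Rightarrow> 'a::euclidean_space \<Rightarrow> ennreal"
  assumes "\<And>i. f i \<in> borel_measurable borel" and "incseq f"
  shows "arcsine_kernel (\<lambda>x. SUP i. f i x) x = (SUP i. arcsine_kernel (f i) x)"
proof -
  have "arcsine_kernel (\<lambda>x. SUP i. f i x) x =
      (\<integral>\<^sup>+r. (SUP i. ennreal (arcsine_density r (norm x)) * f i (r *\<^sub>R (x /\<^sub>R norm x))
          * indicator {0<..} r) \<partial>lborel)"
    unfolding arcsine_kernel_def by (simp add: SUP_mult_left_ennreal SUP_mult_right_ennreal)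
  also have "\<dots> = (SUP i. arcsine_kernel (f i) x)"
    unfolding arcsine_kernel_def
  proof (rule nn_integral_monotone_convergence_SUP)
    show "incseq (\<lambda>i r. ennreal (arcsine_density r (norm x)) * f i (r *\<^sub>R (x /\<^sub>R norm x))
          * indicator {0<..} r)"
      using \<open>incseq f\<close> by (auto simp: incseq_def le_fun_def intro!: mult_mono)
  qed (rule arcsine_integrand_measurable[OF assms(1)])
  finally show ?thesis .
qed

lemma arcsine_kernel_mono:
  assumes "\<And>x. f x \<le> g x"
  shows "arcsine_kernel f x \<le> arcsine_kernel g x"
  unfolding arcsine_kernel_def
  by (intro nn_integral_mono mult_mono assms) auto

lemma measure_space_arcsine_set_function:
  fixes \<nu> :: "'a::euclidean_space measure"
  assumes sets: "sets \<nu> = sets borel"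
  shows "measure_space UNIV (sets borel) (arcsine_set_function \<nu>)"
  unfolding measure_space_def
proof (intro conjI)
  note [measurable_cong] = sets
  show "sigma_algebra UNIV (sets (borel :: 'a measure))"
    by (metis sets.sigma_algebra_axioms space_borel)
  show "positive (sets borel) (arcsine_set_function \<nu>)"
    by (simp add: positive_def arcsine_set_function_def)
  show "countably_additive (sets borel) (arcsine_set_function \<nu>)"
    unfolding countably_additive_def
  proof (intro allI impI)
    fix A :: "nat \<Rightarrow> 'a set"
    assume A: "range A \<subseteq> sets borel" and disj: "disjoint_family A"
    have [measurable]: "A i \<in> sets borel" for i
      using A by auto
    have "(\<Sum>i. arcsine_set_function \<nu> (A i)) =
        (\<integral>\<^sup>+x. (\<Sum>i. arcsine_kernel (indicator (A i)) x * indicator (UNIV - {0}) x) \<partial>\<nu>)"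
      unfolding arcsine_set_function_eq by (rule nn_integral_suminf[symmetric]) measurable
    also have "\<dots> = (\<integral>\<^sup>+x\<in>UNIV - {0}. arcsine_kernel (\<lambda>x. \<Sum>i. indicator (A i) x) x \<partial>\<nu>)"
      by (simp add: arcsine_kernel_suminf)
    also have "\<dots> = arcsine_set_function \<nu> (\<Union>i. A i)"
      unfolding arcsine_set_function_eq suminf_indicator[OF disj] ..
    finally show "(\<Sum>i. arcsine_set_function \<nu> (A i)) = arcsine_set_function \<nu> (\<Union>i. A i)" .
  qed
qed

lemma sets_arcsine_transform [simp, measurable_cong]:
  "sets (arcsine_transform \<nu>) = sets borel"
  unfolding arcsine_transform_def
  by (metis sets.sigma_sets_eq sets_measure_of space_borel subset_Pow_Union top_greatest
      Pow_UNIV)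

lemma emeasure_arcsine_transform:
  assumes sets: "sets \<nu> = sets borel" and B: "B \<in> sets borel"
  shows "emeasure (arcsine_transform \<nu>) B = arcsine_set_function \<nu> B"
  unfolding arcsine_transform_def
  using measure_space_arcsine_set_function[OF sets] B
  by (intro emeasure_measure_of_sigma) (auto simp: measure_space_def)

text \<open>Tonelli's theorem does not apply, because \<open>\<nu>\<close> may fail to be \<open>\<sigma>\<close>-finite. The formula
  extends from indicators to all \<open>f\<close> because its right-hand side is linear and continuous
  along increasing sequences.\<close>

lemma nn_integral_arcsine_transform:
  fixes \<nu> :: "'a::euclidean_space measure"
  assumes sets: "sets \<nu> = sets borel" and f: "f \<in> borel_measurable borel"
  shows "(\<integral>\<^sup>+y. f y \<partial>arcsine_transform \<nu>) = (\<integral>\<^sup>+x\<in>UNIV - {0}. arcsine_kernel f x \<partial>\<nu>)"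
  using f
proof (induction f rule: borel_measurable_induct)
  case (cong f g)
  then have "f = g"
    by auto
  then show ?case
    using cong by simp
next
  case (set A)
  then show ?case
    by (simp add: emeasure_arcsine_transform[OF sets] arcsine_set_function_eq)
next
  note [measurable_cong] = sets
  case (mult u c)
  have [measurable]: "u \<in> borel_measurable borel"
    by fact
  show ?case
    using mult by (simp add: nn_integral_cmult arcsine_kernel_cmult mult.assoc)
next
  note [measurable_cong] = sets
  case (add u v)
  have [measurable]: "u \<in> borel_measurable borel" "v \<in> borel_measurable borel"
    by fact+
  show ?case
    using add by (simp add: nn_integral_add arcsine_kernel_add distrib_right)
next
  note [measurable_cong] = sets
  case (seq U)
  have [measurable]: "U i \<in> borel_measurable borel" for i
    by fact
  have kernel_mono: "incseq (\<lambda>i x. arcsine_kernel (U i) x * indicator (UNIV - {0}) x)"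
    using \<open>incseq U\<close>
    by (auto simp: incseq_def le_fun_def intro!: mult_right_mono arcsine_kernel_mono)
  have "(\<integral>\<^sup>+y. (SUP i. U i y) \<partial>arcsine_transform \<nu>) =
      (SUP i. \<integral>\<^sup>+y. U i y \<partial>arcsine_transform \<nu>)"
    by (rule nn_integral_monotone_convergence_SUP[OF \<open>incseq U\<close>]) measurable
  also have "\<dots> = (SUP i. \<integral>\<^sup>+x\<in>UNIV - {0}. arcsine_kernel (U i) x \<partial>\<nu>)"
    using seq by simp
  also have "\<dots> = (\<integral>\<^sup>+x. (SUP i. arcsine_kernel (U i) x * indicator (UNIV - {0}) x) \<partial>\<nu>)"
    by (rule nn_integral_monotone_convergence_SUP[OF kernel_mono, symmetric]) measurable
  also have "\<dots> = (\<integral>\<^sup>+x\<in>UNIV - {0}. arcsine_kernel (\<lambda>y. SUP i. U i y) x \<partial>\<nu>)"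
    using \<open>incseq U\<close> by (simp add: arcsine_kernel_SUP SUP_mult_right_ennreal)
  finally show ?case
    by (simp add: image_comp SUP_apply[abs_def])
qed

section \<open>Bounds for the kernel\<close>

lemma arcsine_density_nonneg [simp]: "0 \<le> arcsine_density r s"
  by (simp add: arcsine_density_def)

text \<open>The antiderivative is \<open>2 / pi * arcsin (r / sqrt s)\<close>. The density is unbounded at
  \<open>sqrt s\<close>, so the fundamental theorem of calculus is used on the open interval, with the
  limits of the antiderivative at its end points.\<close>

lemma nn_integral_arcsine_density:
  assumes "0 < s"
  shows "(\<integral>\<^sup>+r. ennreal (arcsine_density r s) \<partial>lborel) = 1"
proof -
  define F where "F r = 2 / pi * arcsin (r / sqrt s)" for r
  define f where "f r = 2 / pi * (s - r\<^sup>2) powr (- 1 / 2)" for r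
  define I where "I = {0<..<sqrt s}"
  have pos: "r\<^sup>2 < s" if "r \<in> I" for r
    using that assms unfolding I_def
    by (metis greaterThanLessThan_iff less_eq_real_def power_strict_mono real_sqrt_pow2
        zero_less_numeral)
  have F': "(F has_real_derivative f r) (at r)" if "r \<in> I" for r
  proof -
    have r: "0 < r" "r < sqrt s"
      using that by (auto simp: I_def)
    have "sqrt (s - r\<^sup>2) = sqrt s * sqrt (1 - (r / sqrt s)\<^sup>2)"
      using assms by (simp add: real_sqrt_mult[symmetric] power_divide right_diff_distrib)
    moreover have "0 < s - r\<^sup>2"
      using pos[OF that] by simp
    ultimately have eq: "f r = 2 / pi * (inverse (sqrt (1 - (r / sqrt s)\<^sup>2)) * (1 / sqrt s))"
      by (simp add: f_def powr_minus powr_half_sqrt field_simps)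
    have 1: "-1 < r / sqrt s" "r / sqrt s < 1"
      using r assms by (auto simp: field_simps intro: less_trans[of _ 0])
    show ?thesis
      unfolding eq F_def
      by (rule DERIV_cmult[OF DERIV_chain2[OF DERIV_arcsin[OF 1] DERIV_cdivide[OF DERIV_ident]]])
  qed
  have f_cont: "isCont f r" if "r \<in> I" for r
    unfolding f_def using pos[OF that] by (intro continuous_intros) auto
  have F_cont: "continuous_on {0..sqrt s} F"
    unfolding F_def using assms
    by (intro continuous_intros) (auto simp: field_simps intro: order_trans[of _ 0])
  have lim0: "(F \<longlongrightarrow> F 0) (at_right 0)" and lim1: "(F \<longlongrightarrow> F (sqrt s)) (at_left (sqrt s))"
    using F_cont assms by (auto simp: continuous_on_Icc_at_rightD continuous_on_Icc_at_leftD)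
  have int: "set_integrable lborel I f" and val: "(LBINT r=0..sqrt s. f r) = F (sqrt s) - F 0"
    using interval_integral_FTC_nonneg[of 0 "ereal (sqrt s)" F f "F 0" "F (sqrt s)"]
      F' f_cont lim0 lim1 assms
    by (auto simp: I_def f_def zero_ereal_def ereal_tendsto_simps1 einterval_eq)
  have "(\<integral>\<^sup>+r. ennreal (arcsine_density r s) \<partial>lborel) =
      (\<integral>\<^sup>+r. ennreal (indicator I r *\<^sub>R f r) \<partial>lborel)"
    by (intro nn_integral_cong) (simp add: arcsine_density_def f_def I_def mult.commute)
  also have "\<dots> = ennreal (LBINT r:I. f r)"
    unfolding set_lebesgue_integral_def
    by (rule nn_integral_eq_integral)
       (use int in \<open>auto simp: set_integrable_def f_def indicator_def\<close>)
  also have "(LBINT r:I. f r) = 1"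
    using val assms
    by (simp add: interval_lebesgue_integral_def I_def zero_ereal_def F_def)
  finally show ?thesis
    by simp
qed

text \<open>The density is carried by radii with \<open>r\<^sup>2 < norm x\<close> and has total mass \<open>1\<close>.\<close>

lemma arcsine_kernel_le:
  fixes x :: "'a::euclidean_space"
  assumes "x \<noteq> 0"
  shows "arcsine_kernel (\<lambda>y. ennreal (min 1 ((norm y)\<^sup>2))) x \<le> ennreal (min 1 (norm x))"
proof -
  have "arcsine_kernel (\<lambda>y. ennreal (min 1 ((norm y)\<^sup>2))) x \<le>
      (\<integral>\<^sup>+r. ennreal (min 1 (norm x)) * ennreal (arcsine_density r (norm x)) \<partial>lborel)"
    unfolding arcsine_kernel_def
  proof (rule nn_integral_mono)
    fix r :: real
    show "ennreal (arcsine_density r (norm x)) *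
        ennreal (min 1 ((norm (r *\<^sub>R (x /\<^sub>R norm x)))\<^sup>2)) * indicator {0<..} r
        \<le> ennreal (min 1 (norm x)) * ennreal (arcsine_density r (norm x))"
    proof (cases "r \<in> {0<..<sqrt (norm x)}")
      case True
      then have "r\<^sup>2 \<le> (sqrt (norm x))\<^sup>2"
        by (intro power_mono) auto
      then have "r\<^sup>2 \<le> norm x"
        by simp
      moreover have "norm (r *\<^sub>R (x /\<^sub>R norm x)) = \<bar>r\<bar>"
        using assms by (simp add: abs_mult)
      ultimately have "min 1 ((norm (r *\<^sub>R (x /\<^sub>R norm x)))\<^sup>2) \<le> min 1 (norm x)"
        by (simp only: power2_abs)
      then show ?thesis
        using True by (auto simp: mult.commute intro!: mult_left_mono ennreal_leI)
    qed (simp add: arcsine_density_def)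
  qed
  also have "\<dots> = ennreal (min 1 (norm x))"
    using assms by (simp add: nn_integral_cmult nn_integral_arcsine_density)
  finally show ?thesis .
qed

text \<open>The radii in the upper half of the support suffice: there the density is at least
  \<open>2 / (pi * sqrt (norm x))\<close>, on an interval of length \<open>sqrt (norm x) / 2\<close>, and
  \<open>r\<^sup>2\<close> is at least \<open>norm x / 4\<close>.\<close>

lemma arcsine_kernel_ge:
  fixes x :: "'a::euclidean_space"
  assumes "x \<noteq> 0"
  shows "ennreal (min 1 (norm x) / (4 * pi)) \<le>
    arcsine_kernel (\<lambda>y. ennreal (min 1 ((norm y)\<^sup>2))) x"
proof -
  define t where "t = sqrt (norm x)"
  have t: "0 < t" "norm x = t\<^sup>2"
    using assms by (auto simp: t_def)
  define c where "c = 2 / (pi * t) * (min 1 (norm x) / 4)"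
  have c: "0 \<le> c"
    using t by (simp add: c_def)
  have "ennreal (min 1 (norm x) / (4 * pi)) = ennreal (c * (t - t / 2))"
    using t by (simp add: c_def field_simps)
  also have "\<dots> = (\<integral>\<^sup>+r\<in>{t / 2<..<t}. ennreal c \<partial>lborel)"
    using t c by (simp only: nn_integral_cmult_indicator borel_open open_greaterThanLessThan
        sets_lborel ennreal_mult' emeasure_lborel_Ioo)
  also have "\<dots> \<le> arcsine_kernel (\<lambda>y. ennreal (min 1 ((norm y)\<^sup>2))) x"
    unfolding arcsine_kernel_def
  proof (rule nn_integral_mono)
    fix r :: real
    show "ennreal c * indicator {t / 2<..<t} r \<le> ennreal (arcsine_density r (norm x)) *
        ennreal (min 1 ((norm (r *\<^sub>R (x /\<^sub>R norm x)))\<^sup>2)) * indicator {0<..} r"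
    proof (cases "r \<in> {t / 2<..<t}")
      case True
      then have r: "0 < r" "t / 2 < r" "r < t"
        using t by auto
      have r2: "r\<^sup>2 < t\<^sup>2" "(t / 2)\<^sup>2 \<le> r\<^sup>2"
        using r t by (auto intro!: power_strict_mono power_mono)
      have "sqrt (t\<^sup>2 - r\<^sup>2) \<le> t"
        using t by (intro real_le_lsqrt) auto
      then have "inverse t \<le> inverse (sqrt (t\<^sup>2 - r\<^sup>2))"
        using r2 by (intro le_imp_inverse_le) auto
      then have "2 / pi * inverse t \<le> 2 / pi * inverse (sqrt (t\<^sup>2 - r\<^sup>2))"
        by (intro mult_left_mono) auto
      moreover have "arcsine_density r (norm x) = 2 / pi * inverse (sqrt (t\<^sup>2 - r\<^sup>2))"
        unfolding arcsine_density_def t(2) using r r2(1) t(1)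
        by (simp add: powr_minus powr_half_sqrt)
      moreover have "2 / (pi * t) = 2 / pi * inverse t"
        by (simp add: divide_inverse)
      ultimately have "2 / (pi * t) \<le> arcsine_density r (norm x)"
        by simp
      moreover have "min 1 (norm x) / 4 \<le> min 1 ((norm (r *\<^sub>R (x /\<^sub>R norm x)))\<^sup>2)"
      proof -
        have "norm x / 4 \<le> r\<^sup>2"
          using r2(2) by (simp add: t(2) power_divide)
        moreover have "norm (r *\<^sub>R (x /\<^sub>R norm x)) = \<bar>r\<bar>"
          using assms by (simp add: abs_mult)
        ultimately show ?thesis
          by (simp only: power2_abs)
      qed
      ultimately have "c \<le> arcsine_density r (norm x) * min 1 ((norm (r *\<^sub>R (x /\<^sub>R norm x)))\<^sup>2)"
        unfolding c_def by (intro mult_mono) auto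
      then show ?thesis
        using True r by (simp add: ennreal_mult[symmetric] ennreal_leI)
    qed simp
  qed
  finally show ?thesis .
qed

section \<open>The domain\<close>

text \<open>Since \<open>\<A>\<^sub>1(\<nu>)\<close> is always a measure without mass at the origin, membership in the
  domain is a matter of the integral alone.\<close>

lemma arcsine_domain_iff:
  fixes \<nu> :: "'a::euclidean_space measure"
  shows "\<nu> \<in> arcsine_domain \<longleftrightarrow> sets \<nu> = sets borel \<and> emeasure \<nu> {0} = 0 \<and>
    (\<integral>\<^sup>+x\<in>UNIV - {0}. arcsine_kernel (\<lambda>y. ennreal (min 1 ((norm y)\<^sup>2))) x \<partial>\<nu>) < \<infinity>"
proof (cases "sets \<nu> = sets borel")
  case True
  have "arcsine_kernel (indicator {0}) x = 0" if "x \<noteq> 0" for x :: 'a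
  proof -
    have "ennreal (arcsine_density r (norm x)) * indicator {0} (r *\<^sub>R (x /\<^sub>R norm x))
        * indicator {0<..} r = (0 :: ennreal)" for r
      using that by (cases "r > 0") (simp_all add: indicator_eq_0_iff)
    then show ?thesis
      unfolding arcsine_kernel_def by (simp only: nn_integral_const mult_zero_left)
  qed
  then have "arcsine_kernel (indicator {0}) x * indicator (UNIV - {0}) x = 0" for x :: 'a
    by (cases "x = 0") simp_all
  then have "arcsine_set_function \<nu> {0} = 0"
    unfolding arcsine_set_function_eq by (simp only: nn_integral_const mult_zero_left)
  then have "emeasure (arcsine_transform \<nu>) {0} = 0"
    by (simp add: emeasure_arcsine_transform[OF True])
  then show ?thesis
    using True measure_space_arcsine_set_function[OF True]
    by (simp add: arcsine_domain_def levy_measures_def nn_integral_arcsine_transform[OF True])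
qed (simp add: arcsine_domain_def)

text \<open>The integrability of \<open>min 1 (norm x)\<^sup>2\<close> follows from that of \<open>min 1 (norm x)\<close>, and
  the latter function vanishes at the origin.\<close>

lemma levy_measures1_iff:
  fixes \<nu> :: "'a::euclidean_space measure"
  shows "\<nu> \<in> levy_measures1 \<longleftrightarrow> sets \<nu> = sets borel \<and> emeasure \<nu> {0} = 0 \<and>
    (\<integral>\<^sup>+x\<in>UNIV - {0}. ennreal (min 1 (norm x)) \<partial>\<nu>) < \<infinity>"
proof -
  have "min 1 ((norm x)\<^sup>2) \<le> min 1 (norm x)" for x :: 'a
    using power_decreasing[of 1 2 "norm x"] by (cases "norm x \<le> 1") (auto simp: min_def)
  then have "(\<integral>\<^sup>+x. ennreal (min 1 ((norm x)\<^sup>2)) \<partial>\<nu>) \<le> (\<integral>\<^sup>+x. ennreal (min 1 (norm x)) \<partial>\<nu>)"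
    by (intro nn_integral_mono ennreal_leI)
  moreover have "(\<integral>\<^sup>+x\<in>UNIV - {0}. ennreal (min 1 (norm x)) \<partial>\<nu>) =
      (\<integral>\<^sup>+x. ennreal (min 1 (norm x)) \<partial>\<nu>)"
    by (intro nn_integral_cong) (simp add: indicator_def)
  ultimately show ?thesis
    by (auto simp: levy_measures1_def levy_measures_def intro: le_less_trans)
qed

lemma arcsine_domain_eq_levy_measures1:
  "(arcsine_domain :: 'a::euclidean_space measure set) = levy_measures1"
proof (rule set_eqI)
  fix \<nu> :: "'a measure"
  define K :: "'a \<Rightarrow> ennreal" where "K = arcsine_kernel (\<lambda>y. ennreal (min 1 ((norm y)\<^sup>2)))"
  have "(\<integral>\<^sup>+x\<in>UNIV - {0}. K x \<partial>\<nu>) < \<infinity> \<longleftrightarrow>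
      (\<integral>\<^sup>+x\<in>UNIV - {0}. ennreal (min 1 (norm x)) \<partial>\<nu>) < \<infinity>"
    if sets: "sets \<nu> = sets borel"
  proof
    note [measurable_cong] = sets
    assume fin: "(\<integral>\<^sup>+x\<in>UNIV - {0}. K x \<partial>\<nu>) < \<infinity>"
    have [measurable]: "K \<in> borel_measurable borel"
      unfolding K_def by measurable
    have "(\<integral>\<^sup>+x\<in>UNIV - {0}. ennreal (min 1 (norm x)) \<partial>\<nu>)
        \<le> (\<integral>\<^sup>+x. ennreal (4 * pi) * (K x * indicator (UNIV - {0}) x) \<partial>\<nu>)"
    proof (rule nn_integral_mono)
      fix x :: 'a
      have "ennreal (min 1 (norm x)) \<le> ennreal (4 * pi) * K x" if "x \<noteq> 0"
      proof -
        have "ennreal (min 1 (norm x)) = ennreal (4 * pi) * ennreal (min 1 (norm x) / (4 * pi))"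
          by (simp add: ennreal_mult[symmetric])
        also have "\<dots> \<le> ennreal (4 * pi) * K x"
          unfolding K_def by (intro mult_left_mono arcsine_kernel_ge that) simp
        finally show ?thesis .
      qed
      then show "ennreal (min 1 (norm x)) * indicator (UNIV - {0}) x
          \<le> ennreal (4 * pi) * (K x * indicator (UNIV - {0}) x)"
        by (auto simp: indicator_def)
    qed
    also have "\<dots> = ennreal (4 * pi) * (\<integral>\<^sup>+x\<in>UNIV - {0}. K x \<partial>\<nu>)"
      by (rule nn_integral_cmult) measurable
    also have "\<dots> < \<infinity>"
      using fin by (simp add: ennreal_mult_less_top)
    finally show "(\<integral>\<^sup>+x\<in>UNIV - {0}. ennreal (min 1 (norm x)) \<partial>\<nu>) < \<infinity>" .
  next
    have "(\<integral>\<^sup>+x\<in>UNIV - {0}. K x \<partial>\<nu>) \<le> (\<integral>\<^sup>+x\<in>UNIV - {0}. ennreal (min 1 (norm x)) \<partial>\<nu>)"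
      unfolding K_def by (intro nn_integral_mono) (simp add: indicator_def arcsine_kernel_le)
    also assume "\<dots> < \<infinity>"
    finally show "(\<integral>\<^sup>+x\<in>UNIV - {0}. K x \<partial>\<nu>) < \<infinity>" .
  qed
  then show "\<nu> \<in> arcsine_domain \<longleftrightarrow> \<nu> \<in> levy_measures1"
    unfolding arcsine_domain_iff levy_measures1_iff K_def by blast
qed

theorem proposition2p2:
  shows "(arcsine_domain :: (real ^ 'd) measure set) = levy_measures1"
  by (rule arcsine_domain_eq_levy_measures1)

end
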